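(* Let $G$ be a finite group, let $q\ge2$ and $n\ge 1$. Then $$\lambda_n(q,G)=1+\sum_{1\le k\le n}\binom nk\,\mu_k(q,G).$$
   Context: For a group $Q$, set $\Gamma^1(Q)=Q$, $\Gamma^{i+1}(Q)=[\Gamma^i(Q),Q]$. Let $F_n$ be the free group on $n$ generators, and let $\Gamma^q=\Gamma^q(F_n)$. $Hom(F_n/\Gamma^q,G)$ is the set of homomorphisms $F_n\to G$ trivial on $\Gamma^q$, identified with a subset of $G^n$ by recording the images of the generators. $S_k(q,G)\subset Hom(F_k/\Gamma^q,G)$ is the subset of those $k$-tuples having at least one coordinate equal to $1_G$. $\lambda_n(q,G)$ is the cardinality of $Hom(F_n/\Gamma^q,G)$, and $\mu_k(q,G)$ is the rank of the reduced homology group $\tilde H_0\bigl(Hom(F_k/\Gamma^q,G)/S_k(q,G);\mathbb Z\bigr)$, where the quotient pointed finite set is obtained by collapsing $S_k(q,G)$ to the basepoint; that is, $\mu_k(q,G)$ is the number of elements of $Hom(F_k/\Gamma^q,G)$ with no coordinate equal to $1_G$. *)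

theory Defs
  imports "HOL-Algebra.Generated_Groups" "HOL-Homology.Homology"
begin

text \<open>Words in the letters \<open>(s, True)\<close> (the generator \<open>s\<close>) and \<open>(s, False)\<close> (its formal
  inverse), modulo insertion and deletion of adjacent mutually inverse letters.\<close>

inductive_set free_rel :: "'a set \<Rightarrow> (('a \<times> bool) list \<times> ('a \<times> bool) list) set"
  for S :: "'a set" where
  refl: "w \<in> lists (S \<times> UNIV) \<Longrightarrow> (w, w) \<in> free_rel S"
| sym: "(u, v) \<in> free_rel S \<Longrightarrow> (v, u) \<in> free_rel S"
| trans: "(u, v) \<in> free_rel S \<Longrightarrow> (v, w) \<in> free_rel S \<Longrightarrow> (u, w) \<in> free_rel S"
| cancel: "u \<in> lists (S \<times> UNIV) \<Longrightarrow> v \<in> lists (S \<times> UNIV) \<Longrightarrow> s \<in> S \<Longrightarrow>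
    (u @ [(s, b), (s, \<not> b)] @ v, u @ v) \<in> free_rel S"

definition free_group :: "'a set \<Rightarrow> ('a \<times> bool) list set monoid" where
  "free_group S =
     \<lparr>carrier = lists (S \<times> UNIV) // free_rel S,
      monoid.mult = (\<lambda>A B. \<Union>u\<in>A. \<Union>v\<in>B. free_rel S `` {u @ v}),
      one = free_rel S `` {[]}\<rparr>"

definition free_gen :: "'a set \<Rightarrow> 'a \<Rightarrow> ('a \<times> bool) list set" where
  "free_gen S s = free_rel S `` {[(s, True)]}"

abbreviation F :: "nat \<Rightarrow> (nat \<times> bool) list set monoid" where
  "F n \<equiv> free_group {..<n}"

definition commutator_subgroup :: "('a, 'b) monoid_scheme \<Rightarrow> 'a set \<Rightarrow> 'a set \<Rightarrow> 'a set" where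
  "commutator_subgroup Q H K =
     generate Q (\<Union>h\<in>H. \<Union>k\<in>K. {h \<otimes>\<^bsub>Q\<^esub> k \<otimes>\<^bsub>Q\<^esub> inv\<^bsub>Q\<^esub> h \<otimes>\<^bsub>Q\<^esub> inv\<^bsub>Q\<^esub> k})"

text \<open>The series starts at index 1; the value at index 0 is a dummy.\<close>

fun lower_central :: "('a, 'b) monoid_scheme \<Rightarrow> nat \<Rightarrow> 'a set" where
  "lower_central Q 0 = carrier Q"
| "lower_central Q (Suc 0) = carrier Q"
| "lower_central Q (Suc (Suc i)) =
     commutator_subgroup Q (lower_central Q (Suc i)) (carrier Q)"

text \<open>Homomorphisms \<open>F\<^sub>n \<rightarrow> G\<close> trivial on the \<open>q\<close>-th term of the lower central series. They are
  required to be extensional (\<open>undefined\<close> off the carrier), so that equality of HOL functions is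
  equality of homomorphisms and cardinalities are correct.\<close>

definition nil_hom :: "nat \<Rightarrow> nat \<Rightarrow> ('a, 'b) monoid_scheme \<Rightarrow> ((nat \<times> bool) list set \<Rightarrow> 'a) set" where
  "nil_hom n q G =
     {f \<in> hom (F n) G \<inter> extensional (carrier (F n)).
        \<forall>w \<in> lower_central (F n) q. f w = \<one>\<^bsub>G\<^esub>}"

text \<open>The same set as a subset of \<open>G\<^sup>n\<close>, that is of \<open>{..<n} \<rightarrow>\<^sub>E carrier G\<close>.\<close>

definition nil_hom_tuples :: "nat \<Rightarrow> nat \<Rightarrow> ('a, 'b) monoid_scheme \<Rightarrow> (nat \<Rightarrow> 'a) set" where
  "nil_hom_tuples n q G = (\<lambda>f. \<lambda>i\<in>{..<n}. f (free_gen {..<n} i)) ` nil_hom n q G"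

definition S_tuples :: "nat \<Rightarrow> nat \<Rightarrow> ('a, 'b) monoid_scheme \<Rightarrow> (nat \<Rightarrow> 'a) set" where
  "S_tuples k q G = {g \<in> nil_hom_tuples k q G. \<exists>i<k. g i = \<one>\<^bsub>G\<^esub>}"

text \<open>The quotient \<open>X/A\<close>: points outside \<open>A\<close> become singletons, and \<open>A\<close> itself is the basepoint.
  (For empty \<open>A\<close> this adds a disjoint basepoint, the usual convention.)\<close>

definition collapse :: "'a set \<Rightarrow> 'a set \<Rightarrow> 'a set set" where
  "collapse X A = insert A ((\<lambda>x. {x}) ` (X - A))"

definition Z_independent :: "('a, 'b) monoid_scheme \<Rightarrow> 'a set \<Rightarrow> bool" where
  "Z_independent A B \<longleftrightarrow> finite B \<and> B \<subseteq> carrier A \<and>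
     (\<forall>c :: 'a \<Rightarrow> int. finprod A (\<lambda>x. x [^]\<^bsub>A\<^esub> c x) B = \<one>\<^bsub>A\<^esub> \<longrightarrow> (\<forall>x\<in>B. c x = 0))"

text \<open>The rank of an abelian group, meaningful when it is finite: the supremum of an unbounded
  set of natural numbers is a junk value.\<close>

definition ab_rank :: "('a, 'b) monoid_scheme \<Rightarrow> nat" where
  "ab_rank A = Sup (card ` {B. Z_independent A B})"

definition lambda_num :: "nat \<Rightarrow> nat \<Rightarrow> ('a, 'b) monoid_scheme \<Rightarrow> nat" where
  "lambda_num n q G = card (nil_hom n q G)"

definition mu_num :: "nat \<Rightarrow> nat \<Rightarrow> ('a, 'b) monoid_scheme \<Rightarrow> nat" where
  "mu_num k q G =
     ab_rank (reduced_homology_group 0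
       (discrete_topology (collapse (nil_hom_tuples k q G) (S_tuples k q G))))"

end

theory Submission
  imports Defs
begin

text \<open>
  By the universal property of the free group, a homomorphism \<open>F\<^sub>n \<rightarrow> G\<close> is the same thing as an
  \<open>n\<close>-tuple \<open>g\<close> in \<open>G\<close>. It maps \<open>F\<^sub>n\<close> onto the subgroup generated by the entries of \<open>g\<close>, and a
  surjection carries each term of the lower central series onto the corresponding term. So the
  homomorphism kills \<open>\<Gamma>\<^sup>q\<close> if and only if \<open>\<Gamma>\<^sup>q\<close> of that subgroup is trivial
  (\<open>nil_hom_tuples_iff\<close>). This condition depends only on the set of entries, and it does not change
  when \<open>1\<close> is added to or removed from that set.

  Sort the admissible \<open>n\<close>-tuples by their support, the set of positions with an entry different
  from \<open>1\<close>. Dropping the trivial entries identifies those with a given support of size \<open>k\<close> with the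
  admissible \<open>k\<close>-tuples without trivial entries, so summing over all supports produces the binomial
  coefficients (\<open>card_functions_by_support\<close>). The empty support contributes the summand \<open>1\<close>.

  It remains to see that \<open>\<mu>\<^sub>k\<close> counts the admissible \<open>k\<close>-tuples without trivial entries. These are the
  points other than the basepoint of a finite pointed set, so the claim is that \<open>H\<^sub>0\<close> of a
  discrete space with \<open>N + 1\<close> points has reduced rank \<open>N\<close> (\<open>ab_rank_reduced_homology_discrete\<close>).
  Indeed \<open>H\<^sub>0\<close> is free abelian on the points, and the reduced group is the kernel of a nonzero
  homomorphism to \<open>\<int>\<close>, that is, the set of integer points of a hyperplane
  (\<open>ab_rank_hyperplane\<close>).
\<close>

section \<open>The rank of a lattice hyperplane\<close>

text \<open>Gaussian elimination without division: cross-multiplying with a vector whose coordinate \<open>i\<close> is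
  nonzero clears that coordinate from all the others at the cost of one vector.\<close>

lemma integer_vectors_dependent:
  fixes v :: "'b \<Rightarrow> 's \<Rightarrow> int"
  assumes "finite I" "finite B" "card I < card B"
  shows "\<exists>c. (\<exists>b\<in>B. c b \<noteq> 0) \<and> (\<forall>i\<in>I. (\<Sum>b\<in>B. c b * v b i) = 0)"
  using assms
proof (induction I arbitrary: B v rule: finite_induct)
  case empty
  then obtain b where "b \<in> B" by fastforce
  then show ?case by (intro exI[of _ "\<lambda>_. 1"]) auto
next
  case (insert i I)
  show ?case
  proof (cases "\<forall>b\<in>B. v b i = 0")
    case True
    from insert obtain c where "\<exists>b\<in>B. c b \<noteq> 0" "\<forall>i\<in>I. (\<Sum>b\<in>B. c b * v b i) = 0"
      by (metis card_insert_disjoint Suc_lessD)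
    with True show ?thesis by (intro exI[of _ c]) auto
  next
    case False
    then obtain b0 where b0: "b0 \<in> B" "v b0 i \<noteq> 0" by blast
    \<comment> \<open>Coordinate \<open>i\<close> of every \<open>w b\<close> vanishes.\<close>
    define w where "w = (\<lambda>b j. v b0 i * v b j - v b i * v b0 j)"
    have "card I < card (B - {b0})"
      using insert.prems insert.hyps b0 by simp
    then obtain c where c: "\<exists>b\<in>B - {b0}. c b \<noteq> 0" "\<And>j. j \<in> I \<Longrightarrow> (\<Sum>b\<in>B - {b0}. c b * w b j) = 0"
      using insert.IH[of "B - {b0}" w] insert.prems by auto
    \<comment> \<open>Substituting the definition of \<open>w\<close> turns the relation \<open>c\<close> into one between the original vectors;
      the coefficient of \<open>b0\<close> collects all its occurrences.\<close>
    define d where "d = (\<lambda>b. if b = b0 then - (\<Sum>b\<in>B - {b0}. c b * v b i) else v b0 i * c b)"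
    have split: "(\<Sum>b\<in>B. d b * v b j) = (\<Sum>b\<in>B - {b0}. c b * w b j)" for j
    proof -
      have "(\<Sum>b\<in>B. d b * v b j) = d b0 * v b0 j + (\<Sum>b\<in>B - {b0}. d b * v b j)"
        using insert.prems(1) b0(1) by (rule sum.remove)
      also have "(\<Sum>b\<in>B - {b0}. d b * v b j) = (\<Sum>b\<in>B - {b0}. v b0 i * c b * v b j)"
        by (rule sum.cong) (auto simp: d_def)
      finally show ?thesis
        by (simp add: d_def w_def algebra_simps sum_subtractf sum_distrib_left)
    qed
    have "(\<Sum>b\<in>B. d b * v b j) = 0" if "j \<in> insert i I" for j
    proof (cases "j = i")
      case True
      then show ?thesis unfolding split by (simp add: w_def)
    next
      case False
      with that c show ?thesis unfolding split by auto
    qed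
    moreover have "\<exists>b\<in>B. d b \<noteq> 0"
    proof -
      from c(1) obtain b where "b \<in> B" "b \<noteq> b0" "c b \<noteq> 0" by auto
      with b0 show ?thesis by (intro bexI[of _ b]) (auto simp: d_def)
    qed
    ultimately show ?thesis by (intro exI[of _ d]) blast
  qed
qed

text \<open>The predicate \<open>Z_independent\<close> speaks of multiplicative linear combinations. This formula translates
  them into integer linear combinations of coordinates.\<close>

lemma (in comm_group) additive_finprod_int_pow:
  fixes p :: "'a \<Rightarrow> int"
  assumes add: "\<And>x y. x \<in> carrier G \<Longrightarrow> y \<in> carrier G \<Longrightarrow> p (x \<otimes> y) = p x + p y"
    and B: "B \<subseteq> carrier G"
  shows "p (finprod G (\<lambda>x. x [^] (c x :: int)) B) = (\<Sum>x\<in>B. c x * p x)"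
proof -
  interpret p: group_hom G integer_group p
    by (rule group_hom.intro) (auto intro!: group_hom_axioms.intro homI simp: add)
  have pow: "p (x [^] k) = k * p x" if "x \<in> carrier G" for x and k :: int
    using p.hom_int_pow[OF that, of k] by simp
  have "p \<one> = 0" using p.hom_one by simp
  show ?thesis using B
  proof (induction B rule: infinite_finite_induct)
    case (insert x B)
    have "finprod G (\<lambda>x. x [^] c x) (insert x B) = x [^] c x \<otimes> finprod G (\<lambda>x. x [^] c x) B"
      using insert by (intro finprod_insert) auto
    with insert show ?case by (auto simp: add pow Pi_def subset_iff intro!: finprod_closed)
  qed (simp_all add: \<open>p \<one> = 0\<close>)
qed

text \<open>Here \<open>p\<close> assigns integer coordinates to the elements of \<open>A\<close> and identifies \<open>A\<close> with the integer
  solutions of a single linear equation \<open>\<Sum> a s * v s = 0\<close>. Since \<open>a t\<close> is nonzero, the coordinate \<open>t\<close>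
  of a solution is determined by the others, which bounds the rank by \<open>card S - 1\<close>. The bound is
  attained by the solutions \<open>a t e\<^sub>s - a s e\<^sub>t\<close> for \<open>s \<noteq> t\<close>.\<close>

lemma ab_rank_hyperplane:
  fixes A :: "('a, 'b) monoid_scheme" and p :: "'a \<Rightarrow> 's \<Rightarrow> int" and a :: "'s \<Rightarrow> int"
  assumes "comm_group A" "finite S"
    and add: "\<And>x y s. x \<in> carrier A \<Longrightarrow> y \<in> carrier A \<Longrightarrow> p (x \<otimes>\<^bsub>A\<^esub> y) s = p x s + p y s"
    and inj: "\<And>x. x \<in> carrier A \<Longrightarrow> (\<And>s. s \<in> S \<Longrightarrow> p x s = 0) \<Longrightarrow> x = \<one>\<^bsub>A\<^esub>"
    and eqn: "\<And>x. x \<in> carrier A \<Longrightarrow> (\<Sum>s\<in>S. a s * p x s) = 0"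
    and surj: "\<And>v. (\<Sum>s\<in>S. a s * v s) = 0 \<Longrightarrow> \<exists>x\<in>carrier A. \<forall>s\<in>S. p x s = v s"
    and t: "t \<in> S" "a t \<noteq> 0"
  shows "ab_rank A = card S - 1"
proof -
  interpret A: comm_group A by fact
  define lc where "lc = (\<lambda>c B. finprod A (\<lambda>x. x [^]\<^bsub>A\<^esub> (c x :: int)) B)"
  have p_lc: "p (lc c B) s = (\<Sum>x\<in>B. c x * p x s)" if "B \<subseteq> carrier A" for c B s
    unfolding lc_def by (rule A.additive_finprod_int_pow) (use that add in auto)
  have lc_carrier: "lc c B \<in> carrier A" if "B \<subseteq> carrier A" for c B
    unfolding lc_def using that by (intro A.finprod_closed) auto
  have upper: "card B \<le> card S - 1" if "Z_independent A B" for B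
  proof (rule ccontr)
    assume "\<not> ?thesis"
    then have "card (S - {t}) < card B" using t \<open>finite S\<close> by simp
    moreover have B: "finite B" "B \<subseteq> carrier A" using that by (auto simp: Z_independent_def)
    ultimately obtain c where c: "\<exists>b\<in>B. c b \<noteq> 0" "\<forall>s\<in>S - {t}. (\<Sum>b\<in>B. c b * p b s) = 0"
      using integer_vectors_dependent[of "S - {t}" B p] \<open>finite S\<close> by auto
    have zero: "p (lc c B) s = 0" if "s \<in> S - {t}" for s using c that p_lc[OF B(2)] by simp
    have "0 = (\<Sum>s\<in>S. a s * p (lc c B) s)" using eqn[OF lc_carrier[OF B(2)]] by simp
    also have "\<dots> = a t * p (lc c B) t + (\<Sum>s\<in>S - {t}. a s * p (lc c B) s)"
      using \<open>finite S\<close> t(1) by (rule sum.remove)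
    also have "\<dots> = a t * p (lc c B) t" using zero by simp
    finally have "p (lc c B) s = 0" if "s \<in> S" for s using zero t that by (cases "s = t") auto
    then have "lc c B = \<one>\<^bsub>A\<^esub>" by (rule inj[OF lc_carrier[OF B(2)]])
    with that c show False by (auto simp: Z_independent_def lc_def)
  qed
  define v where "v = (\<lambda>s r. (if r = s then a t else if r = t then - a s else 0))"
  have "\<exists>x\<in>carrier A. \<forall>r\<in>S. p x r = v s r" if "s \<in> S - {t}" for s
  proof (rule surj)
    have "(\<Sum>r\<in>S. a r * v s r) = (\<Sum>r\<in>{s, t}. a r * v s r)"
      using that t \<open>finite S\<close> by (intro sum.mono_neutral_right) (auto simp: v_def)
    then show "(\<Sum>r\<in>S. a r * v s r) = 0" using that by (auto simp: v_def)
  qed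
  then obtain b where b: "\<And>s. s \<in> S - {t} \<Longrightarrow> b s \<in> carrier A"
      "\<And>s r. s \<in> S - {t} \<Longrightarrow> r \<in> S \<Longrightarrow> p (b s) r = v s r"
    by metis
  have inj_b: "inj_on b (S - {t})"
  proof (rule inj_onI)
    fix s r assume sr: "s \<in> S - {t}" "r \<in> S - {t}" "b s = b r"
    then have "v s s = v r s" using b(2)[of s s] b(2)[of r s] by simp
    then show "s = r" using t sr by (auto simp: v_def split: if_splits)
  qed
  have "Z_independent A (b ` (S - {t}))"
    unfolding Z_independent_def
  proof (intro conjI allI impI ballI)
    show "finite (b ` (S - {t}))" using \<open>finite S\<close> by simp
    show sub: "b ` (S - {t}) \<subseteq> carrier A" using b(1) by auto
    fix c :: "'a \<Rightarrow> int" and x assume one: "finprod A (\<lambda>x. x [^]\<^bsub>A\<^esub> c x) (b ` (S - {t})) = \<one>\<^bsub>A\<^esub>" and "x \<in> b ` (S - {t})"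
    then obtain s where s: "s \<in> S - {t}" "x = b s" by blast
    have "p \<one>\<^bsub>A\<^esub> s = 0" using add[of "\<one>\<^bsub>A\<^esub>" "\<one>\<^bsub>A\<^esub>" s] by simp
    then have "0 = p (lc c (b ` (S - {t}))) s" using one by (simp add: lc_def)
    also have "\<dots> = (\<Sum>r\<in>S - {t}. c (b r) * p (b r) s)"
      unfolding p_lc[OF sub] by (simp add: sum.reindex[OF inj_b])
    also have "\<dots> = (\<Sum>r\<in>S - {t}. if r = s then c (b s) * a t else 0)"
      using s b(2) by (intro sum.cong) (auto simp: v_def)
    also have "\<dots> = c (b s) * a t" using s \<open>finite S\<close> by simp
    finally show "c x = 0" using s t by simp
  qed
  moreover have "card (b ` (S - {t})) = card S - 1"
    using card_image[OF inj_b] t \<open>finite S\<close> by simp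
  ultimately show ?thesis
    unfolding ab_rank_def using upper by (intro cSup_eq_maximum) force+
qed


section \<open>Reduced zeroth homology of a finite discrete space\<close>

lemma hom_free_Abelian_group_integer:
  assumes "h \<in> hom (free_Abelian_group S) integer_group" "finite S" "Poly_Mapping.keys x \<subseteq> S"
  shows "h x = (\<Sum>s\<in>S. h (frag_of s) * Poly_Mapping.lookup x s)"
proof -
  interpret h: group_hom "free_Abelian_group S" integer_group h
    using assms(1) by (simp add: group_hom_def group_hom_axioms_def)
  show ?thesis
  proof (rule free_Abelian_group_induct[OF assms(3)])
    show "h 0 = (\<Sum>s\<in>S. h (frag_of s) * Poly_Mapping.lookup 0 s)"
      using h.hom_one by simp
  next
    fix x y :: "'a \<Rightarrow>\<^sub>0 int"
    assume xy: "Poly_Mapping.keys x \<subseteq> S" "Poly_Mapping.keys y \<subseteq> S"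
      "h x = (\<Sum>s\<in>S. h (frag_of s) * Poly_Mapping.lookup x s)"
      "h y = (\<Sum>s\<in>S. h (frag_of s) * Poly_Mapping.lookup y s)"
    have "h (x - y) = h x - h y"
      using h.hom_mult[of x "- y"] h.hom_inv[of y] xy by simp
    with xy show "h (x - y) = (\<Sum>s\<in>S. h (frag_of s) * Poly_Mapping.lookup (x - y) s)"
      by (simp add: lookup_minus algebra_simps sum_subtractf)
  next
    fix s assume "s \<in> S"
    moreover have "(\<Sum>r\<in>S. h (frag_of r) * Poly_Mapping.lookup (frag_of s) r)
        = (\<Sum>r\<in>S. if r = s then h (frag_of s) else 0)"
      by (intro sum.cong) auto
    ultimately show "h (frag_of s) = (\<Sum>r\<in>S. h (frag_of r) * Poly_Mapping.lookup (frag_of s) r)"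
      using assms(2) by simp
  qed
qed

text \<open>The isomorphism of \<open>H\<^sub>0\<close> with the free abelian group on the path components provides
  coordinates. In these, the map to \<open>H\<^sub>0\<close> of a point, which is a copy of \<open>\<int>\<close>, becomes a linear form, and
  the reduced group is its kernel. The form is nonzero because a nonempty space
  retracts onto a point, so the induced map is surjective.\<close>

lemma ab_rank_reduced_homology_discrete:
  assumes "finite P" "P \<noteq> {}"
  shows "ab_rank (reduced_homology_group 0 (discrete_topology P)) = card P - 1"
proof -
  let ?X = "discrete_topology P" and ?U = "discrete_topology {()}"
  let ?H = "homology_group 0 ?X" and ?R = "reduced_homology_group 0 ?X"
  let ?g = "hom_induced 0 ?X {} ?U {} (\<lambda>x. ())"
  define S where "S = path_components_of ?X"
  have S: "finite S" "card S = card P"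
    unfolding S_def path_components_of_def path_component_of_discrete_topology
    using assms by (auto simp: card_image)
  obtain \<psi> \<theta> where "group_isomorphisms ?H (free_Abelian_group S) \<psi> \<theta>"
    unfolding S_def using zeroth_homology_group[of ?X] group.iso_iff_group_isomorphisms[of ?H]
    by (fastforce simp: is_iso_def)
  then have \<psi>: "\<psi> \<in> hom ?H (free_Abelian_group S)" and \<theta>: "\<theta> \<in> hom (free_Abelian_group S) ?H"
    and \<theta>\<psi>: "\<And>x. x \<in> carrier ?H \<Longrightarrow> \<theta> (\<psi> x) = x"
    and \<psi>\<theta>: "\<And>y. y \<in> carrier (free_Abelian_group S) \<Longrightarrow> \<psi> (\<theta> y) = y"
    by (auto simp: group_isomorphisms_def)
  obtain \<kappa> where \<kappa>: "\<kappa> \<in> iso (homology_group 0 ?U) integer_group"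
    using homology_coefficients[of ?U "()"] by (auto simp: is_iso_def)
  have g: "?g \<in> hom ?H (homology_group 0 ?U)" by (rule hom_induced_hom)
  define h where "h = \<kappa> \<circ> ?g"
  have h: "h \<in> hom ?H integer_group" unfolding h_def using g \<kappa> by (auto simp: iso_def intro: hom_compose)
  have kernel: "x \<in> carrier ?R \<longleftrightarrow> x \<in> carrier ?H \<and> h x = 0" for x
  proof -
    have "\<kappa> c = 0 \<longleftrightarrow> c = \<one>\<^bsub>homology_group 0 ?U\<^esub>" if "c \<in> carrier (homology_group 0 ?U)" for c
    proof -
      have "\<kappa> \<in> hom (homology_group 0 ?U) integer_group" "inj_on \<kappa> (carrier (homology_group 0 ?U))"
        using \<kappa> by (simp_all add: iso_def bij_betw_def)
      moreover from this(1) have "\<kappa> \<one>\<^bsub>homology_group 0 ?U\<^esub> = 0"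
        using hom_one[of \<kappa> "homology_group 0 ?U" integer_group] by simp
      ultimately show ?thesis
        using inj_on_eq_iff[of \<kappa> _ c "\<one>\<^bsub>homology_group 0 ?U\<^esub>"] that by (simp add: group.is_monoid)
    qed
    from this[of "?g x"] show ?thesis
      by (simp add: carrier_reduced_homology_group kernel_def h_def hom_induced_carrier)
  qed
  \<comment> \<open>the coefficients of the linear form \<open>h\<close>\<close>
  define a where "a = (\<lambda>s. h (\<theta> (frag_of s)))"
  have h_eq: "h x = (\<Sum>s\<in>S. a s * Poly_Mapping.lookup (\<psi> x) s)" if "x \<in> carrier ?H" for x
  proof -
    have hom: "h \<circ> \<theta> \<in> hom (free_Abelian_group S) integer_group"
      using \<theta> h by (rule hom_compose)
    have "\<psi> x \<in> carrier (free_Abelian_group S)" using hom_in_carrier[OF \<psi> that] .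
    then have "(h \<circ> \<theta>) (\<psi> x) = (\<Sum>s\<in>S. (h \<circ> \<theta>) (frag_of s) * Poly_Mapping.lookup (\<psi> x) s)"
      using S(1) by (intro hom_free_Abelian_group_integer[OF hom]) simp_all
    with that show ?thesis by (simp add: a_def \<theta>\<psi>)
  qed
  obtain t where t: "t \<in> S" "a t \<noteq> 0"
  proof -
    obtain x0 where "x0 \<in> P" using assms by blast
    then have "retraction_map ?X ?U (\<lambda>x. ())"
      by (auto simp: retraction_map_def retraction_maps_def)
    then have "?g ` carrier ?H = carrier (homology_group 0 ?U)"
      by (rule surj_hom_induced_retraction_map[symmetric])
    moreover have "h ` carrier ?H = \<kappa> ` (?g ` carrier ?H)"
      by (simp only: h_def image_comp)
    ultimately have "h ` carrier ?H = UNIV"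
      using \<kappa> by (simp only: iso_def bij_betw_def) simp
    then obtain u where "u \<in> carrier ?H" "h u = 1" by (metis UNIV_I imageE)
    with h_eq have "(\<Sum>s\<in>S. a s * Poly_Mapping.lookup (\<psi> u) s) \<noteq> 0" by auto
    then obtain t where "t \<in> S" "a t * Poly_Mapping.lookup (\<psi> u) t \<noteq> 0"
      by (rule sum.not_neutral_contains_not_neutral)
    with that show ?thesis by simp
  qed
  have "ab_rank ?R = card S - 1"
  proof (rule ab_rank_hyperplane[where p = "\<lambda>x. Poly_Mapping.lookup (\<psi> x)"])
    show "comm_group ?R"
      unfolding reduced_homology_group_def
      by (simp add: abelian_homology_group group.abelian_subgroup_generated)
    show "finite S" by fact
    show "t \<in> S" "a t \<noteq> 0" by fact+
    fix x y s assume "x \<in> carrier ?R" "y \<in> carrier ?R"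
    then show "Poly_Mapping.lookup (\<psi> (x \<otimes>\<^bsub>?R\<^esub> y)) s = Poly_Mapping.lookup (\<psi> x) s + Poly_Mapping.lookup (\<psi> y) s"
      using hom_mult[OF \<psi>] kernel by (simp add: reduced_homology_group_def lookup_add)
  next
    fix x assume x: "x \<in> carrier ?R" "\<And>s. s \<in> S \<Longrightarrow> Poly_Mapping.lookup (\<psi> x) s = 0"
    have "\<psi> x \<in> carrier (free_Abelian_group S)" using hom_in_carrier[OF \<psi>] x kernel by blast
    then have "Poly_Mapping.lookup (\<psi> x) s = 0" for s
      using x(2) by (cases "s \<in> S") (auto simp: in_keys_iff subset_iff)
    then have "\<psi> x = 0" by (simp add: poly_mapping_eqI)
    then have "x = \<theta> 0" using \<theta>\<psi>[of x] x kernel by simp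
    also have "\<dots> = \<one>\<^bsub>?H\<^esub>" using hom_one[OF \<theta>] by simp
    finally show "x = \<one>\<^bsub>?R\<^esub>" by (simp add: one_reduced_homology_group)
  next
    fix x assume "x \<in> carrier ?R"
    then show "(\<Sum>s\<in>S. a s * Poly_Mapping.lookup (\<psi> x) s) = 0" using kernel h_eq by metis
  next
    fix v :: "'a set \<Rightarrow> int" assume v: "(\<Sum>s\<in>S. a s * v s) = 0"
    define y where "y = (\<Sum>s\<in>S. frag_cmul (v s) (frag_of s))"
    have "y \<in> carrier (free_Abelian_group S)"
      unfolding y_def by (rule sum_closed_free_Abelian_group) (use keys_cmul in fastforce)
    moreover have "Poly_Mapping.lookup y s = v s" if "s \<in> S" for s
      using that S(1) by (simp add: y_def lookup_sum if_distrib[of "(*) _"] cong: if_cong)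
    moreover from calculation have "\<theta> y \<in> carrier ?H" by (intro hom_in_carrier[OF \<theta>])
    ultimately have "\<theta> y \<in> carrier ?R \<and> (\<forall>s\<in>S. Poly_Mapping.lookup (\<psi> (\<theta> y)) s = v s)"
      using v \<psi>\<theta> h_eq by (simp add: kernel)
    then show "\<exists>x\<in>carrier ?R. \<forall>s\<in>S. Poly_Mapping.lookup (\<psi> x) s = v s" by blast
  qed
  with S show ?thesis by simp
qed

section \<open>The universal property of the free group\<close>

text \<open>
  Membership of words in \<open>lists (S \<times> UNIV)\<close> is used through the rules for appending and consing. The
  default classical rules would expand it into a statement about sets of letters.
\<close>

declare in_listsI [rule del] in_listsD [rule del]

lemma free_rel_words: "(u, v) \<in> free_rel S \<Longrightarrow> u \<in> lists (S \<times> UNIV) \<and> v \<in> lists (S \<times> UNIV)"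
  by (induction rule: free_rel.induct) auto

lemma equiv_free_rel: "equiv (lists (S \<times> UNIV)) (free_rel S)"
proof (rule equivI)
  show "free_rel S \<subseteq> lists (S \<times> UNIV) \<times> lists (S \<times> UNIV)"
    by (auto dest!: free_rel_words)
  show "refl_on (lists (S \<times> UNIV)) (free_rel S)"
    by (intro refl_onI free_rel.refl)
  show "sym (free_rel S)" by (intro symI) (rule free_rel.sym)
  show "trans (free_rel S)" by (intro transI) (rule free_rel.trans)
qed

lemma free_rel_append_left:
  assumes "(u, v) \<in> free_rel S" "w \<in> lists (S \<times> UNIV)"
  shows "(w @ u, w @ v) \<in> free_rel S"
  using assms
proof (induction rule: free_rel.induct)
  case (cancel u v s b)
  then show ?case using free_rel.cancel[of "w @ u" S v s b] by simp
next
  case (refl u)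
  then show ?case by (intro free_rel.refl) auto
qed (auto intro: free_rel.sym free_rel.trans)

lemma free_rel_append_right:
  assumes "(u, v) \<in> free_rel S" "w \<in> lists (S \<times> UNIV)"
  shows "(u @ w, v @ w) \<in> free_rel S"
  using assms
proof (induction rule: free_rel.induct)
  case (cancel u v s b)
  then show ?case using free_rel.cancel[of u S "v @ w" s b] by simp
next
  case (refl u)
  then show ?case by (intro free_rel.refl) auto
qed (auto intro: free_rel.sym free_rel.trans)

lemma free_rel_append:
  assumes "(u, u') \<in> free_rel S" "(v, v') \<in> free_rel S"
  shows "(u @ v, u' @ v') \<in> free_rel S"
proof (rule free_rel.trans)
  show "(u @ v, u' @ v) \<in> free_rel S"
    using assms free_rel_words[of v] by (intro free_rel_append_right) auto
  show "(u' @ v, u' @ v') \<in> free_rel S"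
    using assms free_rel_words[of u] by (intro free_rel_append_left) auto
qed

abbreviation word_class :: "'a set \<Rightarrow> ('a \<times> bool) list \<Rightarrow> ('a \<times> bool) list set" where
  "word_class S w \<equiv> free_rel S `` {w}"

lemma carrier_free_group: "carrier (free_group S) = word_class S ` lists (S \<times> UNIV)"
  by (auto simp: free_group_def quotient_def)

lemma word_class_in_carrier: "w \<in> lists (S \<times> UNIV) \<Longrightarrow> word_class S w \<in> carrier (free_group S)"
  unfolding carrier_free_group by (rule imageI)

lemma one_free_group: "\<one>\<^bsub>free_group S\<^esub> = word_class S []"
  by (simp add: free_group_def)

lemma word_class_eqI: "(u, v) \<in> free_rel S \<Longrightarrow> word_class S u = word_class S v"
  using equiv_class_eq[OF equiv_free_rel] .

lemma mult_free_group:
  assumes "u \<in> lists (S \<times> UNIV)" "v \<in> lists (S \<times> UNIV)"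
  shows "word_class S u \<otimes>\<^bsub>free_group S\<^esub> word_class S v = word_class S (u @ v)"
proof -
  have "word_class S (u' @ v') = word_class S (u @ v)" if "u' \<in> word_class S u" "v' \<in> word_class S v" for u' v'
    using that by (intro word_class_eqI) (auto intro: free_rel_append free_rel.sym)
  moreover have "u \<in> word_class S u" "v \<in> word_class S v" using assms by (auto intro: free_rel.refl)
  ultimately have "(\<Union>u'\<in>word_class S u. \<Union>v'\<in>word_class S v. word_class S (u' @ v')) = word_class S (u @ v)"
    by (intro UN_constant_eq[of u] UN_constant_eq[of v] ballI)
  then show ?thesis by (simp add: free_group_def)
qed

definition inverse_word :: "('a \<times> bool) list \<Rightarrow> ('a \<times> bool) list" where
  "inverse_word w = rev (map (\<lambda>(s, b). (s, \<not> b)) w)"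

lemma inverse_word_in_lists: "w \<in> lists (S \<times> UNIV) \<Longrightarrow> inverse_word w \<in> lists (S \<times> UNIV)"
  by (auto simp: inverse_word_def in_lists_conv_set)

lemma inverse_word_cancels: "w \<in> lists (S \<times> UNIV) \<Longrightarrow> (inverse_word w @ w, []) \<in> free_rel S"
proof (induction w)
  case (Cons x w)
  obtain s b where x: "x = (s, b)" by fastforce
  have "(inverse_word w @ [(s, \<not> b), (s, \<not> \<not> b)] @ w, inverse_word w @ w) \<in> free_rel S"
    using Cons.prems x by (intro free_rel.cancel inverse_word_in_lists) auto
  then have "(inverse_word (x # w) @ x # w, inverse_word w @ w) \<in> free_rel S"
    by (simp add: x inverse_word_def)
  with Cons show ?case by (auto intro: free_rel.trans)
qed (simp add: inverse_word_def free_rel.refl)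

lemma carrier_free_groupE:
  assumes "x \<in> carrier (free_group S)"
  obtains w where "x = word_class S w" "w \<in> lists (S \<times> UNIV)"
  using assms unfolding carrier_free_group by blast

lemma group_free_group: "group (free_group S)"
proof (rule groupI)
  fix x y assume "x \<in> carrier (free_group S)" "y \<in> carrier (free_group S)"
  then show "x \<otimes>\<^bsub>free_group S\<^esub> y \<in> carrier (free_group S)"
    by (elim carrier_free_groupE) (simp add: word_class_in_carrier mult_free_group)
next
  fix x y z assume "x \<in> carrier (free_group S)" "y \<in> carrier (free_group S)" "z \<in> carrier (free_group S)"
  then show "x \<otimes>\<^bsub>free_group S\<^esub> y \<otimes>\<^bsub>free_group S\<^esub> z = x \<otimes>\<^bsub>free_group S\<^esub> (y \<otimes>\<^bsub>free_group S\<^esub> z)"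
    by (elim carrier_free_groupE) (simp add: mult_free_group)
next
  fix x assume "x \<in> carrier (free_group S)"
  then show "\<one>\<^bsub>free_group S\<^esub> \<otimes>\<^bsub>free_group S\<^esub> x = x"
    by (elim carrier_free_groupE) (simp add: one_free_group mult_free_group)
next
  fix x assume "x \<in> carrier (free_group S)"
  then obtain w where w: "x = word_class S w" "w \<in> lists (S \<times> UNIV)" by (rule carrier_free_groupE)
  show "\<exists>y\<in>carrier (free_group S). y \<otimes>\<^bsub>free_group S\<^esub> x = \<one>\<^bsub>free_group S\<^esub>"
  proof
    show "word_class S (inverse_word w) \<otimes>\<^bsub>free_group S\<^esub> x = \<one>\<^bsub>free_group S\<^esub>"
      unfolding w(1) one_free_group mult_free_group[OF inverse_word_in_lists[OF w(2)] w(2)]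
      by (rule word_class_eqI[OF inverse_word_cancels[OF w(2)]])
    show "word_class S (inverse_word w) \<in> carrier (free_group S)"
      using w(2) by (intro word_class_in_carrier inverse_word_in_lists)
  qed
qed (simp add: one_free_group word_class_in_carrier)

lemma free_gen_in_carrier: "s \<in> S \<Longrightarrow> free_gen S s \<in> carrier (free_group S)"
  by (simp add: free_gen_def word_class_in_carrier)

text \<open>A word class is a product of generators and of their inverses once the one-letter words of both
  signs are recognised as such.\<close>

lemma inv_free_gen: "s \<in> S \<Longrightarrow> inv\<^bsub>free_group S\<^esub> free_gen S s = word_class S [(s, False)]"
proof -
  assume s: "s \<in> S"
  interpret F: group "free_group S" by (rule group_free_group)
  have "word_class S [(s, False)] \<otimes>\<^bsub>free_group S\<^esub> free_gen S s = \<one>\<^bsub>free_group S\<^esub>"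
    using s word_class_eqI[OF free_rel.cancel[of "[]" S "[]" s False]]
    by (simp add: free_gen_def mult_free_group one_free_group)
  with s show ?thesis by (intro F.inv_equality) (simp_all add: word_class_in_carrier free_gen_def)
qed

primrec word_eval :: "('b, 'c) monoid_scheme \<Rightarrow> ('a \<Rightarrow> 'b) \<Rightarrow> ('a \<times> bool) list \<Rightarrow> 'b" where
  "word_eval G g [] = \<one>\<^bsub>G\<^esub>"
| "word_eval G g (x # w) = (if snd x then g (fst x) else inv\<^bsub>G\<^esub> g (fst x)) \<otimes>\<^bsub>G\<^esub> word_eval G g w"

lemma (in group) word_eval_in_generate:
  "w \<in> lists (S \<times> UNIV) \<Longrightarrow> word_eval G g w \<in> generate G (g ` S)"
proof (induction w)
  case (Cons x w)
  then have "(if snd x then g (fst x) else inv g (fst x)) \<in> generate G (g ` S)"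
    by (auto intro: generate.incl generate.inv)
  with Cons show ?case by (auto intro: generate.eng)
qed (simp add: generate.one)

context group begin

lemma word_eval_closed:
  assumes "g \<in> S \<rightarrow> carrier G" "w \<in> lists (S \<times> UNIV)"
  shows "word_eval G g w \<in> carrier G"
proof -
  have "g ` S \<subseteq> carrier G" using assms(1) by auto
  with word_eval_in_generate[OF assms(2)] show ?thesis using generate_in_carrier by blast
qed

lemma word_eval_append:
  assumes "g \<in> S \<rightarrow> carrier G" "u \<in> lists (S \<times> UNIV)" "v \<in> lists (S \<times> UNIV)"
  shows "word_eval G g (u @ v) = word_eval G g u \<otimes> word_eval G g v"
  using assms(2)
proof (induction u)
  case Nil
  then show ?case using word_eval_closed[OF assms(1,3)] by simp
next
  case (Cons x u)
  moreover have "g (fst x) \<in> carrier G" using Cons assms(1) by auto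
  ultimately show ?case
    using word_eval_closed[OF assms(1)] assms(3) by (auto simp: m_assoc)
qed

text \<open>Adjacent mutually inverse letters evaluate to factors that cancel, so evaluation descends to the
  free group.\<close>

lemma word_eval_respects_free_rel:
  assumes "g \<in> S \<rightarrow> carrier G" "(u, v) \<in> free_rel S"
  shows "word_eval G g u = word_eval G g v"
  using assms(2)
proof (induction rule: free_rel.induct)
  case (cancel u v s b)
  then have s: "g s \<in> carrier G" using assms(1) by auto
  have ev: "word_eval G g v \<in> carrier G" using cancel word_eval_closed[OF assms(1)] by simp
  have "word_eval G g ([(s, b), (s, \<not> b)] @ v) = word_eval G g v"
    using s ev by (simp add: m_assoc[symmetric])
  then show ?case
    using cancel word_eval_append[OF assms(1), of u "[(s, b), (s, \<not> b)] @ v"] word_eval_append[OF assms(1), of u v]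
    by simp
qed simp_all

text \<open>A homomorphism is determined by its values on the generators; uniqueness in the universal property
  and the description of the image both follow from this formula.\<close>

lemma hom_free_group_word_eval:
  assumes "f \<in> hom (free_group S) G" "w \<in> lists (S \<times> UNIV)"
  shows "f (word_class S w) = word_eval G (\<lambda>s. f (free_gen S s)) w"
proof -
  interpret F: group "free_group S" by (rule group_free_group)
  interpret f: group_hom "free_group S" G f
    using assms(1) by (simp add: group_hom_def group_hom_axioms_def is_group F.is_group)
  show ?thesis using assms(2)
  proof (induction w)
    case Nil
    then show ?case using f.hom_one by (simp add: one_free_group)
  next
    case (Cons x w)
    obtain s b where x: "x = (s, b)" by fastforce
    with Cons have s: "s \<in> S" and w: "w \<in> lists (S \<times> UNIV)" by auto
    have "word_class S (x # w) = word_class S [x] \<otimes>\<^bsub>free_group S\<^esub> word_class S w"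
      using s w x by (simp add: mult_free_group)
    also have "f \<dots> = f (word_class S [x]) \<otimes> f (word_class S w)"
      using s w x by (intro f.hom_mult) (auto intro: word_class_in_carrier)
    also have "f (word_class S [x]) = (if b then f (free_gen S s) else inv f (free_gen S s))"
      using s x f.hom_inv[OF free_gen_in_carrier[OF s]] by (cases b) (simp_all add: inv_free_gen, simp add: free_gen_def)
    finally show ?case using Cons x by simp
  qed
qed

lemma hom_free_group_image:
  assumes "f \<in> hom (free_group S) G"
  shows "f ` carrier (free_group S) = generate G ((\<lambda>s. f (free_gen S s)) ` S)"
proof
  show "f ` carrier (free_group S) \<subseteq> generate G ((\<lambda>s. f (free_gen S s)) ` S)"
  proof (rule image_subsetI)
    fix x assume "x \<in> carrier (free_group S)"
    then show "f x \<in> generate G ((\<lambda>s. f (free_gen S s)) ` S)"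
      by (elim carrier_free_groupE) (simp add: hom_free_group_word_eval[OF assms] word_eval_in_generate)
  qed
  interpret F: group "free_group S" by (rule group_free_group)
  interpret f: group_hom "free_group S" G f
    using assms(1) by (simp add: group_hom_def group_hom_axioms_def is_group F.is_group)
  show "generate G ((\<lambda>s. f (free_gen S s)) ` S) \<subseteq> f ` carrier (free_group S)"
    by (intro generate_subgroup_incl f.img_is_subgroup) (auto intro!: imageI free_gen_in_carrier)
qed

lemma hom_free_group_eqI:
  assumes "f \<in> hom (free_group S) G" "f' \<in> hom (free_group S) G"
    and "f \<in> extensional (carrier (free_group S))" "f' \<in> extensional (carrier (free_group S))"
    and gens: "\<And>s. s \<in> S \<Longrightarrow> f (free_gen S s) = f' (free_gen S s)"
  shows "f = f'"
proof (rule extensionalityI[OF assms(3,4)])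
  fix x assume "x \<in> carrier (free_group S)"
  then obtain w where w: "x = word_class S w" "w \<in> lists (S \<times> UNIV)" by (rule carrier_free_groupE)
  have "word_eval G (\<lambda>s. f (free_gen S s)) w = word_eval G (\<lambda>s. f' (free_gen S s)) w"
    using w(2) by (induction w) (auto simp: gens)
  with w show "f x = f' x" using assms(1,2) by (simp add: hom_free_group_word_eval)
qed

lemma free_group_universal:
  assumes "g \<in> S \<rightarrow> carrier G"
  obtains f where "f \<in> hom (free_group S) G" "f \<in> extensional (carrier (free_group S))"
    "\<And>s. s \<in> S \<Longrightarrow> f (free_gen S s) = g s"
proof
  define f where "f = (\<lambda>A\<in>carrier (free_group S). word_eval G g (SOME w. w \<in> A))"
  have f: "f (word_class S w) = word_eval G g w" if "w \<in> lists (S \<times> UNIV)" for w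
  proof -
    have "w \<in> word_class S w" using that by (simp add: free_rel.refl)
    then have "(SOME u. u \<in> word_class S w) \<in> word_class S w" by (rule someI)
    then have "word_eval G g w = word_eval G g (SOME u. u \<in> word_class S w)"
      by (intro word_eval_respects_free_rel[OF assms]) simp
    with that show ?thesis by (simp add: f_def word_class_in_carrier)
  qed
  show "f \<in> hom (free_group S) G"
    by (rule homI; elim carrier_free_groupE)
       (simp_all add: mult_free_group f word_eval_closed[OF assms] word_eval_append[OF assms])
  show "f \<in> extensional (carrier (free_group S))" by (simp add: f_def)
  show "f (free_gen S s) = g s" if "s \<in> S" for s
    using that assms by (auto simp: free_gen_def f Pi_iff)
qed
end


section \<open>Lower central series and tuples\<close>

lemma (in group) lower_central_subset: "lower_central G i \<subseteq> carrier G"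
proof (induction i rule: induct_nat_012)
  case (ge2 i)
  have "lower_central G (Suc i) \<subseteq> carrier G" by (rule ge2)
  then show ?case
    unfolding lower_central.simps commutator_subgroup_def by (intro generate_incl UN_least) auto
qed simp_all

text \<open>Surjectivity enters at every step of the series: commutators are taken with arbitrary elements of
  the whole group, all of which have to be hit.\<close>

lemma lower_central_image:
  assumes "group_hom P Q h" "h ` carrier P = carrier Q"
  shows "h ` lower_central P i = lower_central Q i"
proof -
  interpret group_hom P Q h by fact
  show ?thesis
  proof (induction i rule: induct_nat_012)
    case (ge2 i)
    let ?C = "\<lambda>Q H K. (\<Union>h\<in>H. \<Union>k\<in>K. {h \<otimes>\<^bsub>Q\<^esub> k \<otimes>\<^bsub>Q\<^esub> inv\<^bsub>Q\<^esub> h \<otimes>\<^bsub>Q\<^esub> inv\<^bsub>Q\<^esub> k})"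
    have sub: "lower_central P (Suc i) \<subseteq> carrier P" by (rule G.lower_central_subset)
    have comm: "h (a \<otimes>\<^bsub>P\<^esub> b \<otimes>\<^bsub>P\<^esub> inv\<^bsub>P\<^esub> a \<otimes>\<^bsub>P\<^esub> inv\<^bsub>P\<^esub> b) = h a \<otimes>\<^bsub>Q\<^esub> h b \<otimes>\<^bsub>Q\<^esub> inv\<^bsub>Q\<^esub> h a \<otimes>\<^bsub>Q\<^esub> inv\<^bsub>Q\<^esub> h b"
      if "a \<in> carrier P" "b \<in> carrier P" for a b
      using that by simp
    have "?C P (lower_central P (Suc i)) (carrier P) \<subseteq> carrier P"
      using sub by (auto intro!: G.m_closed)
    then have "h ` lower_central P (Suc (Suc i)) = generate Q (h ` ?C P (lower_central P (Suc i)) (carrier P))"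
      by (simp add: commutator_subgroup_def generate_img)
    also have "h ` ?C P (lower_central P (Suc i)) (carrier P)
        = (\<Union>a\<in>lower_central P (Suc i). \<Union>b\<in>carrier P. {h (a \<otimes>\<^bsub>P\<^esub> b \<otimes>\<^bsub>P\<^esub> inv\<^bsub>P\<^esub> a \<otimes>\<^bsub>P\<^esub> inv\<^bsub>P\<^esub> b)})"
      by blast
    also have "\<dots> = (\<Union>a\<in>lower_central P (Suc i). \<Union>b\<in>carrier P. {h a \<otimes>\<^bsub>Q\<^esub> h b \<otimes>\<^bsub>Q\<^esub> inv\<^bsub>Q\<^esub> h a \<otimes>\<^bsub>Q\<^esub> inv\<^bsub>Q\<^esub> h b})"
      using sub by (intro SUP_cong refl arg_cong[of _ _ "\<lambda>x. {x}"] comm) auto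
    also have "\<dots> = ?C Q (h ` lower_central P (Suc i)) (h ` carrier P)"
      by simp
    also have "\<dots> = ?C Q (lower_central Q (Suc i)) (carrier Q)" by (simp only: ge2 assms(2))
    finally show ?case by (simp add: commutator_subgroup_def)
  qed (simp_all add: assms(2))
qed

text \<open>The condition \<open>\<Gamma>\<^sup>q(\<langle>X\<rangle>) = 1\<close> on the subgroup \<open>\<langle>X\<rangle>\<close> of \<open>G\<close>: for positive \<open>q\<close>, nilpotency of class less than \<open>q\<close>. Phrasing
  it for a set of generators makes the order, the repetitions and the indexing of a tuple immaterial.\<close>

definition nilpotent_span :: "('a, 'b) monoid_scheme \<Rightarrow> nat \<Rightarrow> 'a set \<Rightarrow> bool" where
  "nilpotent_span G q X \<longleftrightarrow> lower_central (G\<lparr>carrier := generate G X\<rparr>) q \<subseteq> {\<one>\<^bsub>G\<^esub>}"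

context group begin

lemma nilpotent_span_insert_one:
  assumes "X \<subseteq> carrier G"
  shows "nilpotent_span G q (insert \<one> X) = nilpotent_span G q X"
proof -
  have "generate G (insert \<one> X) = generate G X"
  proof
    show "generate G (insert \<one> X) \<subseteq> generate G X"
      using assms by (intro generate_subgroup_incl generate_is_subgroup) (auto intro: generate.one generate.incl)
  qed (auto intro: mono_generate[THEN subsetD])
  then show ?thesis by (simp add: nilpotent_span_def)
qed

lemma nilpotent_span_empty: "nilpotent_span G q {}"
proof -
  have "subgroup {\<one>} G" by (rule triv_subgroup)
  then have "group (G\<lparr>carrier := {\<one>}\<rparr>)" by (rule subgroup.subgroup_is_group) (rule is_group)
  from group.lower_central_subset[OF this, of q] show ?thesis
    by (simp add: nilpotent_span_def generate_empty)
qed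

text \<open>The homomorphism is corestricted to its image, so that the lower central series is carried onto the
  lower central series of the subgroup generated by the images of the generators.\<close>

lemma hom_kills_lower_central_iff:
  assumes "f \<in> hom (free_group S) G"
  shows "(\<forall>w\<in>lower_central (free_group S) q. f w = \<one>) \<longleftrightarrow> nilpotent_span G q ((\<lambda>s. f (free_gen S s)) ` S)"
proof -
  interpret f: group_hom "free_group S" G f
    using assms group_free_group is_group by (simp add: group_hom_def group_hom_axioms_def)
  let ?Q = "G\<lparr>carrier := f ` carrier (free_group S)\<rparr>"
  have "group ?Q" using f.img_is_subgroup subgroup.subgroup_is_group is_group by blast
  then have "group_hom (free_group S) ?Q f"
    using group_free_group[of S] by (auto simp: group_hom_def group_hom_axioms_def intro!: homI)
  then have "f ` lower_central (free_group S) q = lower_central ?Q q"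
    by (rule lower_central_image) simp
  then show ?thesis
    unfolding nilpotent_span_def hom_free_group_image[OF assms, symmetric] by auto
qed

lemma nil_hom_tuples_iff:
  "g \<in> nil_hom_tuples n q G \<longleftrightarrow> g \<in> {..<n} \<rightarrow>\<^sub>E carrier G \<and> nilpotent_span G q (g ` {..<n})"
proof
  assume "g \<in> nil_hom_tuples n q G"
  then obtain f where f: "f \<in> hom (F n) G" "\<forall>w\<in>lower_central (F n) q. f w = \<one>"
    and g: "g = (\<lambda>i\<in>{..<n}. f (free_gen {..<n} i))"
    by (auto simp: nil_hom_tuples_def nil_hom_def)
  have "g ` {..<n} = (\<lambda>i. f (free_gen {..<n} i)) ` {..<n}" by (simp add: g)
  with f g show "g \<in> {..<n} \<rightarrow>\<^sub>E carrier G \<and> nilpotent_span G q (g ` {..<n})"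
    using hom_kills_lower_central_iff[OF f(1)] hom_in_carrier[OF f(1)] by (auto simp: free_gen_in_carrier)
next
  assume g: "g \<in> {..<n} \<rightarrow>\<^sub>E carrier G \<and> nilpotent_span G q (g ` {..<n})"
  then obtain f where f: "f \<in> hom (F n) G" "f \<in> extensional (carrier (F n))"
    "\<And>i. i \<in> {..<n} \<Longrightarrow> f (free_gen {..<n} i) = g i"
    using free_group_universal[of g "{..<n}"] by (auto simp: PiE_def)
  then have "(\<lambda>i. f (free_gen {..<n} i)) ` {..<n} = g ` {..<n}" by (intro image_cong) auto
  with f g have "f \<in> nil_hom n q G"
    using hom_kills_lower_central_iff[OF f(1)] by (simp add: nil_hom_def)
  moreover have "g = (\<lambda>i\<in>{..<n}. f (free_gen {..<n} i))"
    using f(3) g by (intro extensionalityI[of _ "{..<n}"]) (auto simp: PiE_def)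
  ultimately show "g \<in> nil_hom_tuples n q G" by (auto simp: nil_hom_tuples_def)
qed

lemma card_nil_hom: "card (nil_hom n q G) = card (nil_hom_tuples n q G)"
  unfolding nil_hom_tuples_def
proof (rule card_image[symmetric], rule inj_onI)
  fix f f' assume ff': "f \<in> nil_hom n q G" "f' \<in> nil_hom n q G"
    and "(\<lambda>i\<in>{..<n}. f (free_gen {..<n} i)) = (\<lambda>i\<in>{..<n}. f' (free_gen {..<n} i))"
  then have "f (free_gen {..<n} i) = f' (free_gen {..<n} i)" if "i \<in> {..<n}" for i
    using that by (metis restrict_apply')
  with ff' show "f = f'" by (intro hom_free_group_eqI[of f "{..<n}" f']) (auto simp: nil_hom_def)
qed

end

section \<open>Counting tuples by support\<close>

text \<open>A tuple with support \<open>J\<close> is the same as a function on \<open>J\<close> avoiding \<open>e\<close>, and only the size of \<open>J\<close>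
  matters for counting these, by renumbering. Both steps preserve \<open>P\<close>: extending a tuple by \<open>e\<close> at most
  inserts \<open>e\<close> into its set of entries, and renumbering leaves this set alone.\<close>

lemma card_functions_by_support:
  fixes A :: "'b set" and P :: "'b set \<Rightarrow> bool" and e :: 'b
  assumes "finite A" "e \<in> A" and P_insert: "\<And>X. X \<subseteq> A \<Longrightarrow> P (insert e X) = P X"
  defines "N \<equiv> \<lambda>J :: nat set. {g \<in> J \<rightarrow>\<^sub>E A. P (g ` J) \<and> (\<forall>i\<in>J. g i \<noteq> e)}"
  shows "card {g \<in> {..<n} \<rightarrow>\<^sub>E A. P (g ` {..<n})} = (\<Sum>k\<le>n. (n choose k) * card (N {..<k}))"
proof -
  define T where "T = {g \<in> {..<n} \<rightarrow>\<^sub>E A. P (g ` {..<n})}"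
  define supp where "supp = (\<lambda>g :: nat \<Rightarrow> 'b. {i \<in> {..<n}. g i \<noteq> e})"
  have "finite T" unfolding T_def using \<open>finite A\<close> by (simp add: finite_PiE)
  have restrict: "card {g \<in> T. supp g = J} = card (N J)" if J: "J \<subseteq> {..<n}" for J
  proof (rule bij_betw_same_card)
    \<comment> \<open>If \<open>J\<close> is everything, the value \<open>e\<close> need not occur, hence the case distinction.\<close>
    have image: "P (g ` {..<n}) = P (g ` J)" if "g ` {..<n} \<subseteq> A" "\<And>i. i < n \<Longrightarrow> i \<notin> J \<Longrightarrow> g i = e" for g
    proof (cases "J = {..<n}")
      case False
      with J that have "g ` {..<n} = insert e (g ` J)" by (auto simp: image_iff)
      moreover have "g ` J \<subseteq> A" using J that by blast
      ultimately show ?thesis by (simp add: P_insert)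
    qed simp
    show "bij_betw (\<lambda>g. restrict g J) {g \<in> T. supp g = J} (N J)"
    proof (rule bij_betw_byWitness[where f' = "\<lambda>g. \<lambda>i\<in>{..<n}. if i \<in> J then g i else e"])
      show "\<forall>g\<in>{g \<in> T. supp g = J}. (\<lambda>i\<in>{..<n}. if i \<in> J then restrict g J i else e) = g"
        by (auto simp: T_def supp_def fun_eq_iff PiE_def extensional_def)
      show "\<forall>g\<in>N J. restrict (\<lambda>i\<in>{..<n}. if i \<in> J then g i else e) J = g"
        using J by (auto simp: N_def fun_eq_iff PiE_def extensional_def restrict_def)
      show "(\<lambda>g. restrict g J) ` {g \<in> T. supp g = J} \<subseteq> N J"
      proof clarify
        fix g assume g: "g \<in> T" "J = supp g"
        then have "P (g ` J)" using image[of g] by (auto simp: T_def supp_def)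
        with g show "restrict g (supp g) \<in> N (supp g)"
          by (auto simp: N_def T_def supp_def)
      qed
      show "(\<lambda>g. \<lambda>i\<in>{..<n}. if i \<in> J then g i else e) ` N J \<subseteq> {g \<in> T. supp g = J}"
      proof clarify
        fix g assume g: "g \<in> N J"
        let ?g = "\<lambda>i\<in>{..<n}. if i \<in> J then g i else e"
        have A: "?g \<in> {..<n} \<rightarrow>\<^sub>E A" using g \<open>e \<in> A\<close> by (auto simp: N_def)
        have "P (?g ` {..<n}) = P (?g ` J)"
          by (rule image, rule image_subsetI, rule PiE_mem[OF A]) simp_all
        also have "?g ` J = g ` J" using J by (intro image_cong) auto
        finally have "P (?g ` {..<n})" using g by (simp only: N_def mem_Collect_eq)
        moreover have "supp ?g = J" using J g by (auto simp: supp_def N_def)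
        ultimately show "?g \<in> T \<and> supp ?g = J" using A by (simp add: T_def)
      qed
    qed
  qed
  have reindex: "card (N J) = card (N {..<card J})" if "finite J" for J
  proof -
    obtain h where h: "bij_betw h {..<card J} J"
      using ex_bij_betw_nat_finite[OF \<open>finite J\<close>] unfolding atLeast0LessThan by blast
    let ?h' = "inv_into {..<card J} h"
    note inv = bij_betw_inv_into[OF h]
    have h': "?h' i < card J" "h (?h' i) = i" if "i \<in> J" for i
      using bij_betw_apply[OF inv that] bij_betw_inv_into_right[OF h that] by simp_all
    have h2: "h i \<in> J" "?h' (h i) = i" if "i < card J" for i
      using bij_betw_apply[OF h] bij_betw_inv_into_left[OF h] that by simp_all
    have "(\<lambda>i. g (h i)) ` {..<card J} = g ` J" for g :: "nat \<Rightarrow> 'b"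
      using bij_betw_imp_surj_on[OF h] by (simp flip: image_image)
    moreover have "(\<lambda>i. g (?h' i)) ` J = g ` {..<card J}" for g :: "nat \<Rightarrow> 'b"
      using bij_betw_imp_surj_on[OF inv] by (simp flip: image_image)
    ultimately have imh: "(\<lambda>i\<in>{..<card J}. g (h i)) ` {..<card J} = g ` J"
      "(\<lambda>i\<in>J. g (?h' i)) ` J = g ` {..<card J}" for g :: "nat \<Rightarrow> 'b"
      by (simp_all cong: image_cong_simp)
    have "bij_betw (\<lambda>g. \<lambda>i\<in>{..<card J}. g (h i)) (N J) (N {..<card J})"
    proof (rule bij_betw_byWitness[where f' = "\<lambda>g. \<lambda>i\<in>J. g (?h' i)"])
      show "\<forall>g\<in>N J. (\<lambda>i\<in>J. (\<lambda>i\<in>{..<card J}. g (h i)) (?h' i)) = g"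
        by (auto simp: N_def fun_eq_iff PiE_def extensional_def h')
      show "\<forall>g\<in>N {..<card J}. (\<lambda>i\<in>{..<card J}. (\<lambda>i\<in>J. g (?h' i)) (h i)) = g"
        by (auto simp: N_def fun_eq_iff PiE_def extensional_def h2)
      show "(\<lambda>g. \<lambda>i\<in>{..<card J}. g (h i)) ` N J \<subseteq> N {..<card J}"
      proof (rule image_subsetI)
        fix g assume "g \<in> N J"
        then have g: "g \<in> J \<rightarrow>\<^sub>E A" "P (g ` J)" "\<forall>i\<in>J. g i \<noteq> e" by (simp_all add: N_def)
        show "(\<lambda>i\<in>{..<card J}. g (h i)) \<in> N {..<card J}"
          unfolding N_def mem_Collect_eq imh restrict_PiE_iff
          using g(2,3) PiE_mem[OF g(1)] by (simp add: h2)
      qed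
      show "(\<lambda>g. \<lambda>i\<in>J. g (?h' i)) ` N {..<card J} \<subseteq> N J"
      proof (rule image_subsetI)
        fix g assume "g \<in> N {..<card J}"
        then have g: "g \<in> {..<card J} \<rightarrow>\<^sub>E A" "P (g ` {..<card J})" "\<forall>i\<in>{..<card J}. g i \<noteq> e" by (simp_all add: N_def)
        show "(\<lambda>i\<in>J. g (?h' i)) \<in> N J"
          unfolding N_def mem_Collect_eq imh restrict_PiE_iff
          using g(2,3) PiE_mem[OF g(1)] by (simp add: h')
      qed
    qed
    then show ?thesis by (rule bij_betw_same_card)
  qed
  have supp: "supp ` T \<subseteq> Pow {..<n}" by (auto simp: supp_def)
  have "card T = (\<Sum>J\<in>Pow {..<n}. card {g \<in> T. supp g = J})"
    using sum.group[OF \<open>finite T\<close> _ supp, of "\<lambda>_. 1::nat"] by simp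
  also have "\<dots> = (\<Sum>J\<in>Pow {..<n}. card (N {..<card J}))"
  proof (rule sum.cong[OF HOL.refl])
    fix J assume "J \<in> Pow {..<n}"
    then have "J \<subseteq> {..<n}" "finite J" using finite_subset[of J "{..<n}"] by simp_all
    then show "card {g \<in> T. supp g = J} = card (N {..<card J})" by (simp only: restrict reindex)
  qed
  also have "\<dots> = (\<Sum>k\<le>n. \<Sum>J | J \<in> Pow {..<n} \<and> card J = k. card (N {..<card J}))"
  proof (rule sum.group[symmetric])
    show "card ` Pow {..<n} \<subseteq> {..n}" using card_mono[OF finite_lessThan, of _ n] by auto
  qed simp_all
  also have "\<dots> = (\<Sum>k\<le>n. (n choose k) * card (N {..<k}))"
    using n_subsets[of "{..<n}"] by simp
  finally show ?thesis by (simp add: T_def)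
qed


section \<open>Ranks as numbers of tuples\<close>

text \<open>The collapsed subset is one additional point, also when it is empty; the reduced rank removes this
  point from the count again.\<close>

lemma (in group) mu_num_eq:
  assumes "finite (carrier G)"
  shows "mu_num k q G
    = card {g \<in> {..<k} \<rightarrow>\<^sub>E carrier G. nilpotent_span G q (g ` {..<k}) \<and> (\<forall>i\<in>{..<k}. g i \<noteq> \<one>)}"
proof -
  let ?T = "nil_hom_tuples k q G" and ?S = "S_tuples k q G"
  have "?T \<subseteq> {..<k} \<rightarrow>\<^sub>E carrier G" by (auto simp: nil_hom_tuples_iff)
  then have fin: "finite ?T" by (rule finite_subset) (simp add: assms finite_PiE)
  then have "finite (collapse ?T ?S)" "collapse ?T ?S \<noteq> {}" by (simp_all add: collapse_def)
  then have "mu_num k q G = card (collapse ?T ?S) - 1"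
    unfolding mu_num_def by (rule ab_rank_reduced_homology_discrete)
  also have "card (collapse ?T ?S) = Suc (card (?T - ?S))"
  proof -
    have "?S \<notin> (\<lambda>g. {g}) ` (?T - ?S)" by blast
    with fin show ?thesis by (simp add: collapse_def card_image)
  qed
  also have "?T - ?S = {g \<in> {..<k} \<rightarrow>\<^sub>E carrier G. nilpotent_span G q (g ` {..<k}) \<and> (\<forall>i\<in>{..<k}. g i \<noteq> \<one>)}"
    by (auto simp: S_tuples_def nil_hom_tuples_iff)
  finally show ?thesis by simp
qed

theorem corollary5p4:
  fixes G :: "('a, 'b) monoid_scheme" and q n :: nat
  assumes "group G" and "finite (carrier G)" and "q \<ge> 2" and "n \<ge> 1"
  shows "lambda_num n q G = 1 + (\<Sum>k = 1..n. (n choose k) * mu_num k q G)"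
proof -
  interpret group G by fact
  let ?N = "\<lambda>J :: nat set. {g \<in> J \<rightarrow>\<^sub>E carrier G. nilpotent_span G q (g ` J) \<and> (\<forall>i\<in>J. g i \<noteq> \<one>\<^bsub>G\<^esub>)}"
  have "nil_hom_tuples n q G = {g \<in> {..<n} \<rightarrow>\<^sub>E carrier G. nilpotent_span G q (g ` {..<n})}"
    by (simp only: Set.set_eq_iff nil_hom_tuples_iff mem_Collect_eq simp_thms)
  then have "lambda_num n q G = card {g \<in> {..<n} \<rightarrow>\<^sub>E carrier G. nilpotent_span G q (g ` {..<n})}"
    by (simp only: lambda_num_def card_nil_hom)
  also have "\<dots> = (\<Sum>k\<le>n. (n choose k) * card (?N {..<k}))"
    by (rule card_functions_by_support[where P = "nilpotent_span G q", OF assms(2) one_closed nilpotent_span_insert_one])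
  also have "\<dots> = (n choose 0) * card (?N {..<0}) + (\<Sum>k = 1..n. (n choose k) * card (?N {..<k}))"
    unfolding One_nat_def atMost_atLeast0 by (rule sum.atLeast_Suc_atMost) simp
  also have "(n choose 0) * card (?N {..<0}) = 1"
    by (simp add: nilpotent_span_empty)
  also have "(\<Sum>k = 1..n. (n choose k) * card (?N {..<k})) = (\<Sum>k = 1..n. (n choose k) * mu_num k q G)"
    by (simp only: mu_num_eq[OF assms(2)])
  finally show ?thesis .
qed

end
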